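(* Let $L \geq 1$ and $N \geq 0$ be integers, and let $\lambda_0, \lambda$ be real constants. Define $\mathcal{H}^{\lambda,\lambda_0,L,N} \subset \mathbb{R}^{L(2N+2)+1} = \mathbb{C}^{(N+1)L} \times \mathbb{R}$ by \[ \mathcal{H}^{\lambda,\lambda_0,L,N} = \left\{ \begin{bmatrix} e^{i(\lambda\Theta)} Z \\ \lambda_0 \Theta \end{bmatrix} : \Theta \in \mathbb{R},\ Z \in \mathcal{C}_L\!\left(\tfrac{1}{\sqrt{2}}\mathbb{S}^N \times \tfrac{1}{\sqrt{2}}\mathbb{S}^N\right) \right\}. \] Explicitly, \[ \mathcal{H}^{\lambda,\lambda_0,L,N} = \left\{ \begin{bmatrix} r_1 e^{i(\lambda\Theta)}(X + iY) \\ \vdots \\ r_L e^{i(\lambda\Theta)}(X + iY) \\ \lambda_0\Theta \end{bmatrix} : \Theta, r_1, \dots, r_L \in \mathbb{R},\ \begin{bmatrix} X \\ Y \end{bmatrix} \in \tfrac{1}{\sqrt{2}}\mathbb{S}^N \times \tfrac{1}{\sqrt{2}}\mathbb{S}^N \right\}. \] Then $\mathcal{H}^{\lambda,\lambda_0,L,N}$ is minimal in $\mathbb{R}^{L(2N+2)+1}$. Moreover, it is invariant under the multi-screw motion $\mathcal{S}_\Lambda$ with $\Lambda = (\lambda_0, \lambda, \dots, \lambda)$, that is, $\lambda_1 = \dots = \lambda_L = \lambda$.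
   Context: The Clifford torus $\frac{1}{\sqrt{2}}\mathbb{S}^N \times \frac{1}{\sqrt{2}}\mathbb{S}^N$ is the set \[ \left\{ \tfrac{1}{\sqrt{2}}\begin{bmatrix} X \\ Y \end{bmatrix} \in \mathbb{R}^{2N+2} : \|X\| = \|Y\| = 1 \right\} \subset \mathbb{S}^{2N+1}. \] Points of $\mathbb{R}^{2N+2}$ are identified with $X + iY \in \mathbb{C}^{N+1}$, and $e^{i\alpha}$ acts componentwise. The $L$-rays Clifford cone is \[ \mathcal{C}_L\!\left(\tfrac{1}{\sqrt{2}}\mathbb{S}^N \times \tfrac{1}{\sqrt{2}}\mathbb{S}^N\right) = \left\{ \left(r_1(X + iY), \dots, r_L(X + iY)\right) : r_1, \dots, r_L \in \mathbb{R},\ \|X\| = \|Y\| = 1 \right\} \subset \mathbb{C}^{(N+1)L}. \] For $\Lambda = (\lambda_0, \lambda_1, \dots, \lambda_L)$, the multi-screw motion $\mathcal{S}_\Lambda$ (with parameter $\theta \in \mathbb{R}$) is the map \[ (X_1 + iY_1, \dots, X_L + iY_L, z) \mapsto \left(e^{i(\lambda_1\theta)}(X_1 + iY_1), \dots, e^{i(\lambda_L\theta)}(X_L + iY_L),\ z + \lambda_0\theta\right). \] *)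

theory Defs
  imports "HOL-Analysis.Analysis"
begin

definition pd :: "'k::finite \<Rightarrow> (real^'k \<Rightarrow> 'a::real_normed_vector) \<Rightarrow> real^'k \<Rightarrow> 'a" where
  "pd i f x = frechet_derivative f (at x) (axis i 1)"

definition metric_mat :: "(real^'k::finite \<Rightarrow> 'a::real_inner) \<Rightarrow> real^'k \<Rightarrow> real^'k^'k" where
  "metric_mat \<phi> x = (\<chi> i j. pd i \<phi> x \<bullet> pd j \<phi> x)"

definition normal_proj :: "(real^'k::finite \<Rightarrow> 'a::real_inner) \<Rightarrow> real^'k \<Rightarrow> 'a \<Rightarrow> 'a" where
  "normal_proj \<phi> x v = v - (\<Sum>k\<in>UNIV. \<Sum>l\<in>UNIV.
      (matrix_inv (metric_mat \<phi> x) $ k $ l * (v \<bullet> pd k \<phi> x)) *\<^sub>R pd l \<phi> x)"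

definition mean_curv :: "(real^'k::finite \<Rightarrow> 'a::real_inner) \<Rightarrow> real^'k \<Rightarrow> 'a" where
  "mean_curv \<phi> x = (\<Sum>i\<in>UNIV. \<Sum>j\<in>UNIV.
      matrix_inv (metric_mat \<phi> x) $ i $ j *\<^sub>R normal_proj \<phi> x (pd i (pd j \<phi>) x))"

definition regular_param :: "'a::euclidean_space set \<Rightarrow> (real^'k::finite) set \<Rightarrow> (real^'k \<Rightarrow> 'a) \<Rightarrow> bool" where
  "regular_param M U \<phi> \<longleftrightarrow>
     open U \<and>
     (\<forall>x\<in>U. \<phi> differentiable (at x)) \<and>
     (\<forall>j. \<forall>x\<in>U. pd j \<phi> differentiable (at x)) \<and>
     (\<forall>i j. continuous_on U (pd i (pd j \<phi>))) \<and>
     (\<forall>x\<in>U. inj (frechet_derivative \<phi> (at x))) \<and>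
     (\<exists>\<psi>. homeomorphism U (\<phi> ` U) \<phi> \<psi>) \<and>
     openin (top_of_set M) (\<phi> ` U)"

text \<open>M is minimal: on its regular part (every piece that is an embedded C^2 submanifold,
  parametrized over an open subset of real^'k) the mean curvature vanishes.
  The parameter dimension is a type argument; a theorem with 'k free quantifies over all k.\<close>
definition minimal_set :: "'k::finite itself \<Rightarrow> 'a::euclidean_space set \<Rightarrow> bool" where
  "minimal_set (_ :: 'k itself) M \<longleftrightarrow>
     (\<forall>(U :: (real^'k) set) \<phi>. regular_param M U \<phi> \<longrightarrow> (\<forall>x\<in>U. mean_curv \<phi> x = 0))"

text \<open>The set H^{lambda,lambda0,L,N} in C^{(N+1)L} x R; L = CARD('l), N+1 = CARD('n).\<close>
definition Hset :: "real \<Rightarrow> real \<Rightarrow> (((complex^'n::finite)^'l::finite) \<times> real) set" where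
  "Hset lam lam0 = {((\<chi> l. \<chi> m. complex_of_real (r l) * cis (lam * \<Theta>) * Complex (X $ m) (Y $ m)),
                      lam0 * \<Theta>) | \<Theta> r (X::real^'n) (Y::real^'n). norm X = 1 \<and> norm Y = 1}"

definition multi_screw :: "real \<Rightarrow> ('l::finite \<Rightarrow> real) \<Rightarrow> real \<Rightarrow>
    ((complex^'n::finite)^'l) \<times> real \<Rightarrow> ((complex^'n)^'l) \<times> real" where
  "multi_screw lam0 lams \<theta> p = ((\<chi> l. \<chi> m. cis (lams l * \<theta>) * (fst p $ l $ m)), snd p + lam0 * \<theta>)"

end

(* Let p = phi x. The vector H = mean_curv phi x is orthogonal to the velocity at p of every curve
   running inside M, and it is fixed by the linear part of every affine isometry that fixes p and
   maps M into itself.  At p = (r (x) e^{i alpha} (X + iY), lam0 Theta) two such isometries suffice: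
   minus the reflection of the ray coordinates along r, and the half-turn
   (w, z) |-> (i e^{2 i alpha} cnj (A w), 2 lam0 Theta - z), where the reflection A swaps X and Y.
   The first makes H a multiple of r in the ray coordinates, the velocities obtained by varying r,
   X and Y leave only the direction r (x) e^{i alpha} (X - iY) and the vertical one, and the
   half-turn reverses both.  Neither the dimension of M nor its singular points need separate care. *)

theory Submission
  imports Defs
begin

section \<open>Curves through a point of a parametrized set\<close>

lemma frechet_derivative_eq_sum_pd:
  assumes "\<phi> differentiable (at y)"
  shows "frechet_derivative \<phi> (at y) w = (\<Sum>j\<in>UNIV. (w $ j) *\<^sub>R pd j \<phi> y)"
proof -
  have lin: "linear (frechet_derivative \<phi> (at y))"
    using assms by (rule linear_frechet_derivative)
  have "frechet_derivative \<phi> (at y) w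
      = frechet_derivative \<phi> (at y) (\<Sum>j\<in>UNIV. (w $ j) *\<^sub>R axis j 1)"
    by (simp add: basis_expansion flip: scalar_mult_eq_scaleR)
  also have "\<dots> = (\<Sum>j\<in>UNIV. (w $ j) *\<^sub>R pd j \<phi> y)"
    by (simp add: linear_sum[OF lin] linear_scale[OF lin] pd_def)
  finally show ?thesis .
qed

text \<open>The quadratic form of the Hessian of \<open>\<phi>\<close> at \<open>x\<close>; paired
  with a normal vector it is the second fundamental form on the diagonal.\<close>

definition second_form :: "(real^'k::finite \<Rightarrow> 'a::real_normed_vector) \<Rightarrow> real^'k \<Rightarrow> real^'k \<Rightarrow> 'a" where
  "second_form \<phi> x a = (\<Sum>i\<in>UNIV. \<Sum>j\<in>UNIV. (a $ i * a $ j) *\<^sub>R pd i (pd j \<phi>) x)"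

lemma second_form_scaleR: "second_form \<phi> x (c *\<^sub>R a) = c\<^sup>2 *\<^sub>R second_form \<phi> x a"
  by (simp add: second_form_def scaleR_sum_right power2_eq_square mult_ac)

text \<open>Along the segment from \<open>x\<close> to \<open>x + w\<close> the remainder has a
  derivative assembled from the first order remainders of the partial derivatives at
  \<open>x\<close>. Each of these is small compared with \<open>norm w\<close>, and the components
  of \<open>w\<close> supply the second factor in the mean value inequality.\<close>

lemma taylor_second_order:
  fixes \<phi> :: "real^'k::finite \<Rightarrow> 'a::real_normed_vector"
  assumes "open U" "x \<in> U"
    and d1: "\<And>y. y \<in> U \<Longrightarrow> \<phi> differentiable (at y)"
    and d2: "\<And>j. pd j \<phi> differentiable (at x)"
    and "\<epsilon> > 0"
  shows "\<exists>\<delta>>0. \<forall>w. norm w < \<delta> \<longrightarrow>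
     norm (\<phi> (x + w) - \<phi> x - frechet_derivative \<phi> (at x) w - (1/2) *\<^sub>R second_form \<phi> x w)
       \<le> \<epsilon> * (norm w)\<^sup>2"
proof -
  define D where "D = frechet_derivative \<phi> (at x)"
  have D: "D w = (\<Sum>j\<in>UNIV. (w $ j) *\<^sub>R pd j \<phi> x)" for w
    unfolding D_def using d1[OF \<open>x \<in> U\<close>] by (rule frechet_derivative_eq_sum_pd)
  \<comment> \<open>An equal share of \<open>\<epsilon>\<close> for each of the
    \<open>CARD('k)\<close> summands of \<open>f'\<close> below.\<close>
  define \<eta> where "\<eta> = \<epsilon> / real CARD('k)"
  have "\<eta> > 0" unfolding \<eta>_def using \<open>\<epsilon> > 0\<close> by simp
  obtain \<rho> where \<rho>: "\<rho> > 0" "ball x \<rho> \<subseteq> U"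
    using assms(1,2) by (auto simp: open_contains_ball)
  define P where "P j w = pd j \<phi> (x + w) - pd j \<phi> x - (\<Sum>i\<in>UNIV. (w $ i) *\<^sub>R pd i (pd j \<phi>) x)" for j w
  have "\<exists>\<delta>>0. \<forall>w. norm w < \<delta> \<longrightarrow> norm (P j w) \<le> \<eta> * norm w" for j
  proof -
    have "(pd j \<phi> has_derivative frechet_derivative (pd j \<phi>) (at x)) (at x)"
      using d2 by (simp add: frechet_derivative_works[symmetric])
    then obtain \<delta> where "\<delta> > 0" and \<delta>: "\<And>y. norm (y - x) < \<delta> \<Longrightarrow>
        norm (pd j \<phi> y - pd j \<phi> x - frechet_derivative (pd j \<phi>) (at x) (y - x)) \<le> \<eta> * norm (y - x)"
      using \<open>\<eta> > 0\<close> unfolding has_derivative_at_alt by blast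
    have "norm (P j w) \<le> \<eta> * norm w" if "norm w < \<delta>" for w
      using \<delta>[of "x + w"] that by (simp add: P_def frechet_derivative_eq_sum_pd[OF d2])
    with \<open>\<delta> > 0\<close> show ?thesis by blast
  qed
  then obtain \<delta> where \<delta>: "\<And>j. \<delta> j > 0" "\<And>j w. norm w < \<delta> j \<Longrightarrow> norm (P j w) \<le> \<eta> * norm w"
    by metis
  define d where "d = min \<rho> (Min (range \<delta>))"
  have "d > 0" using \<rho> \<delta> by (simp add: d_def)
  have d: "d \<le> \<rho>" "\<And>j. d \<le> \<delta> j" by (auto simp: d_def min.coboundedI2)
  have "norm (\<phi> (x + w) - \<phi> x - D w - (1/2) *\<^sub>R second_form \<phi> x w) \<le> \<epsilon> * (norm w)\<^sup>2"
    if w: "norm w < d" for w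
  proof -
    \<comment> \<open>\<open>f 1 - f 0\<close> is the remainder to be bounded, and \<open>f'\<close>
      is the derivative of \<open>f\<close> expressed through the remainders
      \<open>P\<close>.\<close>
    define f where "f t = \<phi> (x + t *\<^sub>R w) - t *\<^sub>R D w - (t\<^sup>2 / 2) *\<^sub>R second_form \<phi> x w" for t
    define f' where "f' t = (\<Sum>j\<in>UNIV. (w $ j) *\<^sub>R P j (t *\<^sub>R w))" for t
    have f'eq: "f' t = frechet_derivative \<phi> (at (x + t *\<^sub>R w)) w - D w - t *\<^sub>R second_form \<phi> x w"
      if "x + t *\<^sub>R w \<in> U" for t
    proof -
      have "second_form \<phi> x w = (\<Sum>j\<in>UNIV. \<Sum>i\<in>UNIV. (w $ i * w $ j) *\<^sub>R pd i (pd j \<phi>) x)"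
        unfolding second_form_def by (rule sum.swap)
      then show ?thesis
        unfolding f'_def P_def D frechet_derivative_eq_sum_pd[OF d1[OF that]]
        by (simp add: scaleR_diff_right sum_subtractf scaleR_sum_right mult_ac)
    qed
    have tw: "norm (t *\<^sub>R w) < d" if "t \<in> {0..1}" for t
    proof -
      have "\<bar>t\<bar> * norm w \<le> 1 * norm w" using that by (intro mult_right_mono) auto
      with w show ?thesis by simp
    qed
    have inU: "x + t *\<^sub>R w \<in> U" if "t \<in> {0..1}" for t
      using tw[OF that] d \<rho> by (intro subsetD[OF \<rho>(2)]) (auto simp: dist_norm)
    have "norm (f 1 - f 0) \<le> (\<epsilon> * (norm w)\<^sup>2) * norm (1 - 0 :: real)"
    proof (rule differentiable_bound[where S = "{0..1}" and f' = "\<lambda>t h. h *\<^sub>R f' t"])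
      fix t :: real assume t: "t \<in> {0..1}"
      have "(\<phi> has_derivative frechet_derivative \<phi> (at (x + t *\<^sub>R w))) (at (x + t *\<^sub>R w))"
        using d1[OF inU[OF t]] by (simp add: frechet_derivative_works[symmetric])
      then have "((\<lambda>s. \<phi> (x + s *\<^sub>R w)) has_derivative
          (\<lambda>h. frechet_derivative \<phi> (at (x + t *\<^sub>R w)) (h *\<^sub>R w))) (at t within {0..1})"
        by (rule has_derivative_compose[rotated]) (auto intro!: derivative_eq_intros)
      moreover have "((\<lambda>s. s *\<^sub>R D w) has_derivative (\<lambda>h. h *\<^sub>R D w)) (at t within {0..1})"
        by (rule has_derivative_scaleR_left[OF has_derivative_ident])
      moreover have "((\<lambda>s. s\<^sup>2 / 2) has_derivative (\<lambda>h. h * t)) (at t within {0..1})"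
        by (auto intro!: derivative_eq_intros)
      then have "((\<lambda>s. (s\<^sup>2 / 2) *\<^sub>R second_form \<phi> x w) has_derivative
          (\<lambda>h. (h * t) *\<^sub>R second_form \<phi> x w)) (at t within {0..1})"
        by (rule has_derivative_scaleR_left)
      ultimately have "(f has_derivative (\<lambda>h. frechet_derivative \<phi> (at (x + t *\<^sub>R w)) (h *\<^sub>R w)
          - h *\<^sub>R D w - (h * t) *\<^sub>R second_form \<phi> x w)) (at t within {0..1})"
        unfolding f_def by (intro has_derivative_diff)
      moreover have "linear (frechet_derivative \<phi> (at (x + t *\<^sub>R w)))"
        using d1[OF inU[OF t]] by (rule linear_frechet_derivative)
      ultimately show "(f has_derivative (\<lambda>h. h *\<^sub>R f' t)) (at t within {0..1})"
        unfolding f'eq[OF inU[OF t]] by (simp add: linear_scale scaleR_diff_right)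
      have "norm (f' t) \<le> (\<Sum>j\<in>(UNIV::'k set). norm w * (\<eta> * norm w))"
        unfolding f'_def
      proof (rule order_trans[OF norm_sum], rule sum_mono)
        fix j
        have "norm (P j (t *\<^sub>R w)) \<le> \<eta> * norm (t *\<^sub>R w)"
          using tw[OF t] d(2)[of j] by (intro \<delta>) auto
        also have "\<dots> \<le> \<eta> * norm w"
          using \<open>\<eta> > 0\<close> t by (auto intro!: mult_left_mono mult_left_le_one_le)
        finally show "norm (w $ j *\<^sub>R P j (t *\<^sub>R w)) \<le> norm w * (\<eta> * norm w)"
          by (simp add: mult_mono component_le_norm_cart)
      qed
      also have "\<dots> = \<epsilon> * (norm w)\<^sup>2" by (simp add: \<eta>_def power2_eq_square)
      finally show "onorm (\<lambda>h. h *\<^sub>R f' t) \<le> \<epsilon> * (norm w)\<^sup>2"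
        by (intro onorm_le) (simp add: mult.commute mult_left_mono)
    qed auto
    then show ?thesis by (simp add: f_def algebra_simps)
  qed
  with \<open>d > 0\<close> show ?thesis unfolding D_def by blast
qed

text \<open>The linear term of the expansion is tangential, so \<open>\<nu>\<close> does not see it,
  whatever the second order behaviour of \<open>u\<close>. The quadratic term is homogeneous of
  degree two, so after division by \<open>t\<^sup>2\<close> it depends only on the difference
  quotient of \<open>u\<close>, which tends to \<open>b\<close>.\<close>

lemma second_form_along_curve:
  fixes \<phi> :: "real^'k::finite \<Rightarrow> 'a::real_inner"
  assumes "open U" "x \<in> U"
    and d1: "\<And>y. y \<in> U \<Longrightarrow> \<phi> differentiable (at y)"
    and d2: "\<And>j. pd j \<phi> differentiable (at x)"
    and u: "(u has_vector_derivative b) (at 0)" "u 0 = x"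
    and \<nu>: "\<And>w. frechet_derivative \<phi> (at x) w \<bullet> \<nu> = 0"
  shows "((\<lambda>t. ((\<phi> (u t) - \<phi> x) \<bullet> \<nu>) / t\<^sup>2) \<longlongrightarrow> (second_form \<phi> x b \<bullet> \<nu>) / 2) (at 0)"
proof -
  define v where "v t = (1 / t) *\<^sub>R (u t - x)" for t
  define R where "R w = \<phi> (x + w) - \<phi> x - frechet_derivative \<phi> (at x) w - (1/2) *\<^sub>R second_form \<phi> x w" for w
  have v: "(v \<longlongrightarrow> b) (at 0)"
  proof -
    have "((\<lambda>t. norm (u t - x - t *\<^sub>R b) / norm t) \<longlongrightarrow> 0) (at 0)"
      using u unfolding has_vector_derivative_def has_derivative_at by simp
    moreover have "\<forall>\<^sub>F t in at 0. norm (u t - x - t *\<^sub>R b) / norm t = norm (v t - b)"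
      unfolding eventually_at_filter
    proof (intro always_eventually allI impI)
      fix t :: real assume "t \<noteq> 0"
      then have "v t - b = (1 / t) *\<^sub>R (u t - x - t *\<^sub>R b)"
        by (simp add: v_def scaleR_diff_right)
      then show "norm (u t - x - t *\<^sub>R b) / norm t = norm (v t - b)" by simp
    qed
    ultimately have "((\<lambda>t. norm (v t - b)) \<longlongrightarrow> 0) (at 0)"
      by (rule Lim_transform_eventually)
    then show ?thesis by (rule LIM_zero_cancel[OF tendsto_norm_zero_cancel])
  qed
  have Qv: "((\<lambda>t. second_form \<phi> x (v t) \<bullet> \<nu> / 2) \<longlongrightarrow> (second_form \<phi> x b \<bullet> \<nu>) / 2) (at 0)"
    unfolding second_form_def by (intro tendsto_intros v) auto
  have u0: "(u \<longlongrightarrow> x) (at 0)"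
    using has_vector_derivative_continuous[OF u(1)] u(2) by (simp add: isCont_def)
  have R0: "((\<lambda>t. (R (u t - x) \<bullet> \<nu>) / t\<^sup>2) \<longlongrightarrow> 0) (at 0)"
  proof (rule tendstoI)
    fix e :: real assume "e > 0"
    \<comment> \<open>The first added 1 leaves room for the difference quotients \<open>v t\<close>
      near 0, the second keeps \<open>K\<close> positive even for \<open>\<nu> = 0\<close>. The
      factor 2 in \<open>\<epsilon>\<close> makes the final estimate strict.\<close>
    define K where "K = (norm b + 1)\<^sup>2 * (norm \<nu> + 1)"
    have "K > 0" unfolding K_def by (intro mult_pos_pos zero_less_power add_nonneg_pos) auto
    define \<epsilon> where "\<epsilon> = e / (2 * K)"
    have "\<epsilon> > 0" using \<open>e > 0\<close> \<open>K > 0\<close> by (simp add: \<epsilon>_def)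
    from taylor_second_order[OF assms(1,2) d1 d2 this] obtain \<delta> where "\<delta> > 0"
      and \<delta>: "\<And>w. norm w < \<delta> \<Longrightarrow> norm (R w) \<le> \<epsilon> * (norm w)\<^sup>2"
      unfolding R_def by blast
    have "\<forall>\<^sub>F t in at 0. norm (u t - x) < \<delta>"
      using tendstoD[OF u0 \<open>\<delta> > 0\<close>] by (simp add: dist_norm)
    moreover have "\<forall>\<^sub>F t in at 0. norm (v t) < norm b + 1"
      using order_tendstoD(2)[OF tendsto_norm[OF v], of "norm b + 1"] by simp
    moreover have "\<forall>\<^sub>F t::real in at 0. t \<noteq> 0" by (simp add: eventually_at_filter)
    ultimately show "\<forall>\<^sub>F t in at 0. dist ((R (u t - x) \<bullet> \<nu>) / t\<^sup>2) 0 < e"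
    proof eventually_elim
      case (elim t)
      have "norm (u t - x) = \<bar>t\<bar> * norm (v t)" using elim by (simp add: v_def)
      then have "norm (R (u t - x)) \<le> \<epsilon> * (t\<^sup>2 * (norm (v t))\<^sup>2)"
        using \<delta>[OF elim(1)] by (simp add: power_mult_distrib)
      also have "\<dots> \<le> \<epsilon> * (t\<^sup>2 * (norm b + 1)\<^sup>2)"
        using elim \<open>\<epsilon> > 0\<close> by (intro mult_left_mono power_mono) auto
      finally have "norm (R (u t - x)) * norm \<nu> \<le> \<epsilon> * (t\<^sup>2 * (norm b + 1)\<^sup>2) * (norm \<nu> + 1)"
        using \<open>\<epsilon> > 0\<close> by (intro mult_mono) auto
      then have "\<bar>R (u t - x) \<bullet> \<nu>\<bar> \<le> \<epsilon> * K * t\<^sup>2"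
        unfolding K_def using Cauchy_Schwarz_ineq2[of "R (u t - x)" \<nu>] by (simp add: mult_ac)
      also have "\<dots> = (e / 2) * t\<^sup>2" using \<open>K > 0\<close> by (simp add: \<epsilon>_def)
      finally have "\<bar>R (u t - x) \<bullet> \<nu>\<bar> / t\<^sup>2 \<le> e / 2" using elim by (simp add: divide_le_eq)
      with \<open>e > 0\<close> have "\<bar>R (u t - x) \<bullet> \<nu>\<bar> / t\<^sup>2 < e" by linarith
      then show ?case by (simp add: abs_divide)
    qed
  qed
  \<comment> \<open>At \<open>t = 0\<close> both sides are 0, because division by zero yields zero
    and so \<open>v 0 = 0\<close>.\<close>
  have eq: "((\<phi> (u t) - \<phi> x) \<bullet> \<nu>) / t\<^sup>2
      = second_form \<phi> x (v t) \<bullet> \<nu> / 2 + (R (u t - x) \<bullet> \<nu>) / t\<^sup>2" for t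
    using \<nu>[of "u t - x"]
    unfolding v_def second_form_scaleR R_def
    by (simp add: inner_diff_left power_divide diff_divide_distrib)
  show ?thesis
    unfolding eq using tendsto_add[OF Qv R0] by simp
qed

text \<open>The lifted curve is differentiable because \<open>\<phi>\<close> is an immersion, and stays in \<open>U\<close> because the
  image of \<open>\<phi>\<close> is open in \<open>M\<close>.\<close>

lemma curve_lift:
  fixes \<phi> :: "real^'k::finite \<Rightarrow> 'a::euclidean_space"
  assumes reg: "regular_param M U \<phi>" and "x \<in> U"
    and c: "(c has_vector_derivative v) (at 0)" "c 0 = \<phi> x"
    and cM: "\<forall>\<^sub>F t in at 0. c t \<in> M"
  obtains u b where "u 0 = x" "(u has_vector_derivative b) (at 0)"
    "\<forall>\<^sub>F t in nhds 0. \<phi> (u t) = c t" "frechet_derivative \<phi> (at x) b = v"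
proof -
  define D where "D = frechet_derivative \<phi> (at x)"
  obtain \<psi> where \<psi>: "homeomorphism U (\<phi> ` U) \<phi> \<psi>"
    using reg by (auto simp: regular_param_def)
  have "\<phi> differentiable (at x)" using reg \<open>x \<in> U\<close> by (auto simp: regular_param_def)
  then have D: "(\<phi> has_derivative D) (at x)" unfolding D_def by (simp add: frechet_derivative_works[symmetric])
  have "inj D" unfolding D_def using reg \<open>x \<in> U\<close> by (auto simp: regular_param_def)
  then obtain D' where D': "linear D'" "D' \<circ> D = id"
    using linear_injective_left_inverse[OF has_derivative_linear[OF D]] by blast
  have bl: "bounded_linear D'" using D'(1) linear_conv_bounded_linear by blast
  obtain K where "K > 0" and K: "\<And>y. norm (D' y) \<le> norm y * K"
    using bounded_linear.pos_bounded[OF bl] by blast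
  obtain O' where O': "open O'" "\<phi> ` U = M \<inter> O'"
    using reg by (auto simp: regular_param_def openin_open)
  have c0: "(c \<longlongrightarrow> \<phi> x) (at 0)"
    using has_vector_derivative_continuous[OF c(1)] c(2) by (simp add: isCont_def)
  have "\<forall>\<^sub>F t in at 0. c t \<in> O'"
    using topological_tendstoD[OF c0 O'(1)] \<open>x \<in> U\<close> O'(2) by blast
  with cM have evim0: "\<forall>\<^sub>F t in at 0. c t \<in> \<phi> ` U"
    by eventually_elim (use O' in auto)
  then have evim: "\<forall>\<^sub>F t in nhds 0. c t \<in> \<phi> ` U"
    using c(2) \<open>x \<in> U\<close> by (simp add: eventually_nhds_conv_at)
  define u where "u t = \<psi> (c t)" for t
  have u0: "u 0 = x" using \<psi> \<open>x \<in> U\<close> c(2) by (simp add: u_def homeomorphism_apply1)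
  have lift: "\<forall>\<^sub>F t in nhds 0. \<phi> (u t) = c t"
    using evim by eventually_elim (auto simp: u_def homeomorphism_apply2[OF \<psi>])
  have ulim: "(u \<longlongrightarrow> x) (at 0)"
  proof -
    have "continuous_on (\<phi> ` U) \<psi>" using \<psi> by (simp add: homeomorphism_def)
    then have "((\<lambda>t. \<psi> (c t)) \<longlongrightarrow> \<psi> (\<phi> x)) (at 0)"
      by (rule continuous_on_tendsto_compose[OF _ c0 imageI[OF \<open>x \<in> U\<close>] evim0])
    then show ?thesis using u0 c(2) unfolding u_def by simp
  qed
  define b where "b = D' v"
  \<comment> \<open>Applying the left inverse \<open>D'\<close> to the first order expansion of
    \<open>\<phi>\<close> recovers \<open>y - x\<close> with an error relative to
    \<open>norm (y - x)\<close>; the factor \<open>K\<close> bounds \<open>D'\<close>.\<close>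
  have E: "\<exists>\<delta>>0. \<forall>y. norm (y - x) < \<delta> \<longrightarrow> norm (y - x - D' (\<phi> y - \<phi> x)) \<le> e * norm (y - x)"
    if "e > 0" for e
  proof -
    have "e / K > 0" using that \<open>K > 0\<close> by simp
    then obtain \<delta> where "\<delta> > 0" and \<delta>: "\<And>y. norm (y - x) < \<delta> \<Longrightarrow>
        norm (\<phi> y - \<phi> x - D (y - x)) \<le> e / K * norm (y - x)"
      using D unfolding has_derivative_at_alt by blast
    have "norm (y - x - D' (\<phi> y - \<phi> x)) \<le> e * norm (y - x)" if "norm (y - x) < \<delta>" for y
    proof -
      have "y - x - D' (\<phi> y - \<phi> x) = - D' (\<phi> y - \<phi> x - D (y - x))"
        using D' by (simp add: linear_diff pointfree_idE)
      then have "norm (y - x - D' (\<phi> y - \<phi> x)) \<le> norm (\<phi> y - \<phi> x - D (y - x)) * K"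
        using K by simp
      also have "\<dots> \<le> (e / K * norm (y - x)) * K"
        using \<delta>[OF that] \<open>K > 0\<close> by (intro mult_right_mono) auto
      finally show ?thesis using \<open>K > 0\<close> by simp
    qed
    with \<open>\<delta> > 0\<close> show ?thesis by blast
  qed
  have D'c: "((\<lambda>t. D' (c t)) has_derivative (\<lambda>h. h *\<^sub>R b)) (at 0)"
    using bounded_linear.has_vector_derivative[OF bl c(1)]
    unfolding has_vector_derivative_def b_def .
  have "(u has_derivative (\<lambda>h. h *\<^sub>R b)) (at 0)"
    unfolding has_derivative_within_alt2[where s = UNIV]
  proof (intro conjI allI impI)
    show "bounded_linear (\<lambda>h. h *\<^sub>R b)" by (rule bounded_linear_scaleR_left)
    fix e :: real assume "e > 0"
    define L where "L = norm b + 1"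
    have "L > 0" unfolding L_def by (intro add_nonneg_pos) auto
    have C: "\<forall>\<^sub>F t in at 0. norm (D' (c t) - D' (c 0) - (t - 0) *\<^sub>R b) \<le> \<mu> * norm (t - 0)" if "\<mu> > 0" for \<mu>
      using D'c that unfolding has_derivative_within_alt2 by blast
    have E': "\<forall>\<^sub>F t in at 0. norm (u t - x - D' (c t - c 0)) \<le> \<mu> * norm (u t - x)" if \<mu>: "\<mu> > 0" for \<mu>
    proof -
      obtain \<delta> where "\<delta> > 0" and \<delta>: "\<And>y. norm (y - x) < \<delta> \<Longrightarrow>
          norm (y - x - D' (\<phi> y - \<phi> x)) \<le> \<mu> * norm (y - x)"
        using E[OF \<mu>] by blast
      have "\<forall>\<^sub>F t in at 0. norm (u t - x) < \<delta>"
        using tendstoD[OF ulim \<open>\<delta> > 0\<close>] by (simp add: dist_norm)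
      moreover have "\<forall>\<^sub>F t in at 0. \<phi> (u t) = c t"
        using lift by (simp add: eventually_nhds_conv_at)
      ultimately show ?thesis
      proof eventually_elim
        case (elim t)
        then show ?case using \<delta>[of "u t"] c(2) by simp
      qed
    qed
    \<comment> \<open>The error in \<open>E'\<close> is relative to \<open>norm (u t - x)\<close>,
      not to \<open>t\<close>. Using it first with factor 1/2 and absorbing gives
      \<open>norm (u t - x) \<le> 2 * L * \<bar>t\<bar>\<close>; with factor \<open>\<mu>\<close>
      the error is then at most \<open>e / 2 * \<bar>t\<bar>\<close>.\<close>
    define \<mu> where "\<mu> = e / (4 * L)"
    have "\<mu> > 0" using \<open>e > 0\<close> \<open>L > 0\<close> by (simp add: \<mu>_def)
    have "e / 2 > 0" using \<open>e > 0\<close> by simp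
    have "\<forall>\<^sub>F t in at 0. norm (u t - u 0 - (t - 0) *\<^sub>R b) \<le> e * norm (t - 0)"
      using C[OF \<open>e / 2 > 0\<close>] C[OF zero_less_one] E'[OF \<open>\<mu> > 0\<close>] E'[of "1/2", simplified]
    proof eventually_elim
      case (elim t)
      have d: "D' (c t - c 0) = D' (c t) - D' (c 0)" using D'(1) by (simp add: linear_diff)
      have "norm (D' (c t - c 0)) \<le> norm (t *\<^sub>R b) + \<bar>t\<bar>"
        using norm_triangle_ineq[of "D' (c t - c 0) - t *\<^sub>R b" "t *\<^sub>R b"] elim(2) d by simp
      moreover have "norm (u t - x) \<le> norm (D' (c t - c 0)) + norm (u t - x - D' (c t - c 0))"
        using norm_triangle_ineq[of "D' (c t - c 0)" "u t - x - D' (c t - c 0)"] by simp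
      ultimately have "norm (u t - x) \<le> 2 * L * \<bar>t\<bar>"
        using elim(4) by (simp add: L_def algebra_simps)
      then have "norm (u t - x - D' (c t - c 0)) \<le> \<mu> * (2 * L * \<bar>t\<bar>)"
        using elim(3) \<open>\<mu> > 0\<close> by (meson mult_left_mono less_imp_le order_trans)
      also have "\<dots> = e / 2 * \<bar>t\<bar>" using \<open>L > 0\<close> by (simp add: \<mu>_def)
      finally have "norm (u t - x - D' (c t - c 0)) \<le> e / 2 * \<bar>t\<bar>" .
      moreover have "norm (u t - x - t *\<^sub>R b)
          \<le> norm (u t - x - D' (c t - c 0)) + norm (D' (c t - c 0) - t *\<^sub>R b)"
        by (rule order_trans[OF eq_refl norm_triangle_ineq]) (simp add: algebra_simps)
      ultimately show ?case using elim(1) d u0 by simp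
    qed
    then show "\<forall>\<^sub>F t in at 0. norm (u t - u 0 - (t - 0) *\<^sub>R b) \<le> e * norm (t - 0)" .
  qed
  then have ud: "(u has_vector_derivative b) (at 0)" by (simp add: has_vector_derivative_def)
  have "((\<lambda>t. \<phi> (u t)) has_derivative (\<lambda>h. D (h *\<^sub>R b))) (at 0)"
    using has_derivative_compose[OF ud[unfolded has_vector_derivative_def], of \<phi> D] D u0 by simp
  then have "(c has_derivative (\<lambda>h. D (h *\<^sub>R b))) (at 0)"
    by (rule has_derivative_transform_eventually)
      (use lift u0 c(2) in \<open>auto simp: eventually_nhds_conv_at\<close>)
  then have "(\<lambda>h. D (h *\<^sub>R b)) = (\<lambda>h. h *\<^sub>R v)"
    using c(1) unfolding has_vector_derivative_def by (rule has_derivative_unique)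
  then have "D b = v" by (metis scaleR_one)
  with u0 ud lift show thesis using that unfolding D_def by blast
qed

section \<open>Invariance of the mean curvature vector under isometries\<close>

lemma matrix_inv_inverse:
  assumes "invertible A"
  shows "A ** matrix_inv A = mat 1" "matrix_inv A ** A = mat 1"
  using someI_ex[OF assms[unfolded invertible_def]] unfolding matrix_inv_def by auto

lemma metric_mat_mult_vec:
  assumes "\<phi> differentiable (at x)"
  shows "(metric_mat \<phi> x *v a) $ i = pd i \<phi> x \<bullet> frechet_derivative \<phi> (at x) a"
  unfolding frechet_derivative_eq_sum_pd[OF assms] matrix_vector_mult_def metric_mat_def
  by (simp add: inner_sum_right mult.commute)

lemma inner_metric_mat:
  assumes "\<phi> differentiable (at x)"
  shows "a \<bullet> (metric_mat \<phi> x *v b)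
       = frechet_derivative \<phi> (at x) a \<bullet> frechet_derivative \<phi> (at x) b"
  unfolding frechet_derivative_eq_sum_pd[OF assms, of a] inner_vec_def
  by (simp add: metric_mat_mult_vec[OF assms] inner_sum_left)

text \<open>The Gram matrix pairs \<open>a\<close> with itself to the squared length of its image
  under the differential, so its kernel lies in that of an injective map.\<close>

lemma invertible_metric_mat:
  assumes "\<phi> differentiable (at x)" "inj (frechet_derivative \<phi> (at x))"
  shows "invertible (metric_mat \<phi> x)"
proof -
  have "a = 0" if "metric_mat \<phi> x *v a = 0" for a
  proof -
    have "frechet_derivative \<phi> (at x) a = 0"
      using inner_metric_mat[OF assms(1), of a a] that by simp
    then show ?thesis
      using linear_injective_0[OF linear_frechet_derivative[OF assms(1)]] assms(2) by blast
  qed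
  then show ?thesis by (simp add: invertible_left_inverse matrix_left_invertible_ker)
qed

lemma inner_normal_proj:
  assumes "\<And>k. pd k \<phi> x \<bullet> \<nu> = 0"
  shows "normal_proj \<phi> x v \<bullet> \<nu> = v \<bullet> \<nu>"
  unfolding normal_proj_def by (simp add: inner_diff_left inner_sum_left assms)

text \<open>Pairing the subtracted sum with \<open>pd m \<phi> x\<close> produces the product of the
  inverse metric with the metric, so exactly \<open>v \<bullet> pd m \<phi> x\<close> is
  removed.\<close>

lemma normal_proj_orthogonal:
  assumes "invertible (metric_mat \<phi> x)"
  shows "normal_proj \<phi> x v \<bullet> pd m \<phi> x = 0"
proof -
  define G where "G = matrix_inv (metric_mat \<phi> x)"
  have "(\<Sum>k\<in>UNIV. \<Sum>l\<in>UNIV. (G $ k $ l * (v \<bullet> pd k \<phi> x)) * (pd l \<phi> x \<bullet> pd m \<phi> x))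
      = (\<Sum>k\<in>UNIV. (v \<bullet> pd k \<phi> x) * (G ** metric_mat \<phi> x) $ k $ m)"
    by (simp add: matrix_matrix_mult_def metric_mat_def sum_distrib_left mult_ac)
  also have "\<dots> = v \<bullet> pd m \<phi> x"
    unfolding G_def matrix_inv_inverse(2)[OF assms] by (simp add: mat_def if_distrib sum.delta cong: if_cong)
  finally show ?thesis
    unfolding normal_proj_def by (simp add: inner_diff_left inner_sum_left G_def)
qed

lemma mean_curv_orthogonal:
  assumes "\<phi> differentiable (at x)" "invertible (metric_mat \<phi> x)"
  shows "frechet_derivative \<phi> (at x) w \<bullet> mean_curv \<phi> x = 0"
  unfolding frechet_derivative_eq_sum_pd[OF assms(1)] mean_curv_def
  using normal_proj_orthogonal[OF assms(2), THEN trans[OF inner_commute]]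
  by (simp add: inner_sum_left inner_sum_right)

section \<open>Metric traces of quadratic forms and the mean curvature\<close>

lemma inner_transpose_mult_vec:
  fixes S :: "real^'n^'m"
  shows "a \<bullet> (transpose S *v z) = (S *v a) \<bullet> z"
  by (metis dot_lmul_matrix inner_commute transpose_matrix_vector)

text \<open>Since \<open>S\<close> preserves \<open>g\<close>, it satisfies
  \<open>S ** G ** transpose S = G\<close>, so pulling \<open>b\<close> back by \<open>S\<close>
  does not change its trace against \<open>G\<close>. The pullback and \<open>c\<close> agree as
  quadratic forms, hence differ by an antisymmetric matrix, whose trace against the symmetric
  \<open>G\<close> vanishes.\<close>

lemma trace_congruence:
  fixes g G S b c :: "real^'k^'k"
  assumes g: "transpose g = g" "g ** G = mat 1"
    and S: "transpose S ** g ** S = g"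
    and bc: "\<And>a. (S *v a) \<bullet> (b *v (S *v a)) = a \<bullet> (c *v a)"
  shows "trace (G ** b) = trace (G ** c)"
proof -
  have Gg: "G ** g = mat 1" using g(2) matrix_left_right_inverse by blast
  have GT: "transpose G = G"
  proof -
    have "transpose G ** g = mat 1"
      using arg_cong[OF g(2), of transpose] by (simp add: matrix_transpose_mul g(1) transpose_mat)
    then have "transpose G ** g ** G = G" by simp
    then show ?thesis using g(2) by (metis matrix_mul_assoc matrix_mul_rid)
  qed
  \<comment> \<open>This left inverse of the square matrix \<open>S\<close> is also a right inverse;
    multiplying that identity by \<open>G\<close> on the right gives \<open>SG\<close>.\<close>
  have "(G ** transpose S ** g) ** S = mat 1"
    using S Gg by (simp add: matrix_mul_assoc[symmetric])
  then have "S ** (G ** transpose S ** g) = mat 1" using matrix_left_right_inverse by blast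
  then have "S ** G ** transpose S ** (g ** G) = G" by (simp add: matrix_mul_assoc)
  then have SG: "S ** G ** transpose S = G" using g(2) by simp
  define d where "d = transpose S ** b ** S - c"
  have d0: "a \<bullet> (d *v a) = 0" for a
  proof -
    have "a \<bullet> (transpose S ** b ** S *v a) = (S *v a) \<bullet> (b *v (S *v a))"
      by (simp only: matrix_vector_mul_assoc[symmetric] inner_transpose_mult_vec)
    then show ?thesis using bc[of a] by (simp add: d_def matrix_vector_mult_diff_rdistrib inner_diff_right)
  qed
  have anti: "d $ i $ j = - d $ j $ i" for i j
  proof -
    have e: "axis i 1 \<bullet> (d *v axis j 1) = d $ i $ j" for i j
      by (simp add: inner_axis' matrix_vector_mul_component column_def matrix_vector_mult_basis)
    have "(axis i 1 + axis j 1) \<bullet> (d *v (axis i 1 + axis j 1)) = 0" by (rule d0)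
    then have "axis i 1 \<bullet> (d *v axis j 1) + axis j 1 \<bullet> (d *v axis i 1) = 0"
      by (simp add: matrix_vector_right_distrib inner_add_left inner_add_right d0)
    then show ?thesis unfolding e by linarith
  qed
  have "trace (G ** d) = trace (transpose (G ** d))"
    by (simp add: trace_def transpose_def)
  also have "\<dots> = trace (transpose d ** G)" by (simp add: matrix_transpose_mul GT)
  also have "transpose d = - d" by (simp add: vec_eq_iff transpose_def) (blast intro: anti)
  also have "trace (- d ** G) = - trace (G ** d)"
    by (subst trace_mul_sym) (simp add: trace_def matrix_matrix_mult_def sum_negf)
  finally have "trace (G ** d) = 0" by simp
  moreover have "trace (G ** d) = trace (G ** (transpose S ** b ** S)) - trace (G ** c)"
  proof -
    have "trace (G ** (P - Q)) = trace (G ** P) - trace (G ** Q)" for P Q :: "real^'k^'k"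
      by (simp add: trace_def matrix_matrix_mult_def sum_subtractf right_diff_distrib)
    then show ?thesis by (simp add: d_def)
  qed
  moreover have "trace (G ** (transpose S ** b ** S)) = trace (S ** G ** transpose S ** b)"
    by (metis trace_mul_sym matrix_mul_assoc)
  ultimately show ?thesis using SG by simp
qed

text \<open>A normal vector does not see the normal projection. The derivatives in the matrix appear
  in transposed order because the trace pairs the entry \<open>i, j\<close> of the inverse metric
  with the entry \<open>j, i\<close>.\<close>

lemma mean_curv_inner_normal:
  assumes "\<And>k. pd k \<phi> x \<bullet> \<nu> = 0"
  shows "mean_curv \<phi> x \<bullet> \<nu>
    = trace (matrix_inv (metric_mat \<phi> x) ** (\<chi> i j. pd j (pd i \<phi>) x \<bullet> \<nu>))"
  unfolding mean_curv_def trace_def matrix_matrix_mult_def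
  by (simp add: inner_sum_left inner_normal_proj[OF assms])

lemma second_form_inner:
  "second_form \<phi> x a \<bullet> \<nu> = a \<bullet> ((\<chi> i j. pd j (pd i \<phi>) x \<bullet> \<nu>) *v a)"
proof -
  have "second_form \<phi> x a \<bullet> \<nu> = (\<Sum>j\<in>UNIV. \<Sum>i\<in>UNIV. (a $ i * a $ j) * (pd i (pd j \<phi>) x \<bullet> \<nu>))"
    unfolding second_form_def by (subst sum.swap) (simp add: inner_sum_left)
  then show ?thesis
    by (simp add: inner_vec_def matrix_vector_mult_def sum_distrib_left mult_ac)
qed

text \<open>The lift of the curve exhibits \<open>v\<close> as a value of the differential, hence as
  a tangent vector. Explicit curves in \<open>M\<close> thus constrain the mean curvature of any
  parametrization, whatever its dimension.\<close>

lemma curve_velocity_orthogonal_mean_curv: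
  fixes \<phi> :: "real^'k::finite \<Rightarrow> 'a::euclidean_space"
  assumes reg: "regular_param M U \<phi>" and x: "x \<in> U"
    and c: "(c has_vector_derivative v) (at 0)" "c 0 = \<phi> x" "\<forall>\<^sub>F t in at 0. c t \<in> M"
  shows "v \<bullet> mean_curv \<phi> x = 0"
proof -
  have d: "\<phi> differentiable (at x)" "inj (frechet_derivative \<phi> (at x))"
    using reg x by (auto simp: regular_param_def)
  obtain b where "frechet_derivative \<phi> (at x) b = v"
    using curve_lift[OF reg x c] by blast
  then show ?thesis
    using mean_curv_orthogonal[OF d(1) invertible_metric_mat[OF d]] by blast
qed

text \<open>No second derivative of the induced change of parameters is needed: \<open>second_form\<close> paired with
  a normal vector is read off from \<open>\<phi>\<close> along any once differentiable curve in the parameter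
  domain, so it suffices to lift the images of straight lines.\<close>

theorem mean_curv_fixed_by_isometry:
  fixes \<phi> :: "real^'k::finite \<Rightarrow> 'a::euclidean_space"
  assumes reg: "regular_param M U \<phi>" and x: "x \<in> U"
    and \<sigma>: "orthogonal_transformation \<sigma>"
    and \<sigma>M: "\<And>q. q \<in> M \<Longrightarrow> \<phi> x + \<sigma> (q - \<phi> x) \<in> M"
  shows "\<sigma> (mean_curv \<phi> x) = mean_curv \<phi> x"
proof -
  define D where "D = frechet_derivative \<phi> (at x)"
  define H where "H = mean_curv \<phi> x"
  have oU: "open U" and d1: "\<And>y. y \<in> U \<Longrightarrow> \<phi> differentiable (at y)"
    and d2: "\<And>j. pd j \<phi> differentiable (at x)"
    and inj: "inj D"
    using reg x by (auto simp: regular_param_def D_def)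
  have lin\<sigma>: "linear \<sigma>" and \<sigma>i: "\<And>v w. \<sigma> v \<bullet> \<sigma> w = v \<bullet> w"
    using \<sigma> by (auto simp: orthogonal_transformation_def)
  have linD: "linear D" unfolding D_def using d1[OF x] by (rule linear_frechet_derivative)
  have inv: "invertible (metric_mat \<phi> x)" using invertible_metric_mat d1[OF x] inj by (simp add: D_def)
  have HD: "D w \<bullet> H = 0" for w
    unfolding D_def H_def using mean_curv_orthogonal[OF d1[OF x] inv] .
  obtain D' where D': "linear D'" "D' \<circ> D = id"
    using linear_injective_left_inverse[OF linD inj] by blast
  \<comment> \<open>The expected differential at \<open>x\<close> of the change of parameters
    induced by the isometry \<open>\<lambda>q. \<phi> x + \<sigma> (q - \<phi> x)\<close>. That
    \<open>D (s a) = \<sigma> (D a)\<close> holds, so that \<open>\<sigma>\<close> preserves the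
    tangent space, comes from \<open>lift\<close>.\<close>
  define s where "s = D' \<circ> \<sigma> \<circ> D"
  have lins: "linear s" unfolding s_def by (intro linear_compose linD lin\<sigma> D')
  have bl\<sigma>: "bounded_linear \<sigma>" using lin\<sigma> linear_conv_bounded_linear by blast
  define c where "c a t = \<phi> x + \<sigma> (\<phi> (x + t *\<^sub>R a) - \<phi> x)" for a t
  have line: "((\<lambda>t. x + t *\<^sub>R a) has_vector_derivative a) (at 0)" for a
    by (auto intro!: derivative_eq_intros)
  have lift: "\<exists>u. u 0 = x \<and> (u has_vector_derivative s a) (at 0) \<and> (\<forall>\<^sub>F t in at 0. \<phi> (u t) = c a t)
      \<and> D (s a) = \<sigma> (D a)" for a
  proof -
    have "(\<phi> has_derivative D) (at x)"
      unfolding D_def using d1[OF x] by (simp add: frechet_derivative_works[symmetric])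
    then have "((\<lambda>t. \<phi> (x + t *\<^sub>R a)) has_derivative (\<lambda>h. D (h *\<^sub>R a))) (at 0)"
      using has_derivative_compose[OF line[unfolded has_vector_derivative_def], of \<phi> D] by simp
    then have "((\<lambda>t. \<phi> (x + t *\<^sub>R a)) has_vector_derivative D a) (at 0)"
      by (simp add: has_vector_derivative_def linear_scale[OF linD])
    then have "((\<lambda>t. \<phi> (x + t *\<^sub>R a) - \<phi> x) has_vector_derivative D a) (at 0)"
      by (auto intro!: derivative_eq_intros)
    then have "((\<lambda>t. \<sigma> (\<phi> (x + t *\<^sub>R a) - \<phi> x)) has_vector_derivative \<sigma> (D a)) (at 0)"
      by (rule bounded_linear.has_vector_derivative[OF bl\<sigma>])
    then have cd: "(c a has_vector_derivative \<sigma> (D a)) (at 0)"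
      unfolding c_def by (auto intro!: derivative_eq_intros)
    have c0: "c a 0 = \<phi> x" by (simp add: c_def linear_0[OF lin\<sigma>])
    have "((\<lambda>t. x + t *\<^sub>R a) \<longlongrightarrow> x + 0 *\<^sub>R a) (at 0)" by (intro tendsto_intros)
    then have "\<forall>\<^sub>F t in at 0. x + t *\<^sub>R a \<in> U"
      using topological_tendstoD[OF _ oU] x by fastforce
    then have "\<forall>\<^sub>F t in at 0. c a t \<in> M"
    proof eventually_elim
      case (elim t)
      have "\<phi> (x + t *\<^sub>R a) \<in> M"
        using reg elim by (auto simp: regular_param_def openin_open)
      then show ?case unfolding c_def by (rule \<sigma>M)
    qed
    then obtain u b where u: "u 0 = x" "(u has_vector_derivative b) (at 0)"
      "\<forall>\<^sub>F t in nhds 0. \<phi> (u t) = c a t" "D b = \<sigma> (D a)"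
      using curve_lift[OF reg x cd c0] unfolding D_def by blast
    have "b = s a" using u(4) D'(2) by (simp add: s_def flip: u(4)) (simp add: pointfree_idE)
    with u show ?thesis by (auto simp: eventually_nhds_conv_at)
  qed
  have Ds: "D (s a) = \<sigma> (D a)" for a using lift by blast
  \<comment> \<open>An isometry and an injective differential kill nothing, so \<open>s\<close> is
    injective and, in finite dimension, surjective. Every tangent vector is then
    \<open>\<sigma>\<close> of a tangent vector, which makes \<open>\<sigma> H\<close>
    normal.\<close>
  have "s a = 0 \<Longrightarrow> a = 0" for a
    using Ds[of a] \<sigma>i[of "D a" "D a"] linD inj linear_injective_0 by (fastforce simp: linear_0)
  then have "inj s" using linear_injective_0[OF lins] by blast
  then have "surj s" using lins linear_injective_imp_surjective by blast
  have \<sigma>H: "D w \<bullet> \<sigma> H = 0" for w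
  proof -
    obtain a where "w = s a" using \<open>surj s\<close> by blast
    then show ?thesis using HD[of a] by (simp add: Ds \<sigma>i)
  qed
  \<comment> \<open>The isometry takes the image of the line through \<open>x\<close> to the image
    of \<open>u\<close>, so the two quotients are equal; each limit is a value of the second
    fundamental form.\<close>
  have Qs: "second_form \<phi> x (s a) \<bullet> \<sigma> H = second_form \<phi> x a \<bullet> H" for a
  proof -
    obtain u where u: "u 0 = x" "(u has_vector_derivative s a) (at 0)"
      "\<forall>\<^sub>F t in at 0. \<phi> (u t) = c a t"
      using lift by blast
    have "((\<lambda>t. ((\<phi> (u t) - \<phi> x) \<bullet> \<sigma> H) / t\<^sup>2) \<longlongrightarrow> (second_form \<phi> x (s a) \<bullet> \<sigma> H) / 2) (at 0)"
      by (rule second_form_along_curve[OF oU x d1 d2 u(2,1) \<sigma>H[unfolded D_def]])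
    moreover have "\<forall>\<^sub>F t in at 0. ((\<phi> (u t) - \<phi> x) \<bullet> \<sigma> H) / t\<^sup>2
        = ((\<phi> (x + t *\<^sub>R a) - \<phi> x) \<bullet> H) / t\<^sup>2"
      using u(3) by eventually_elim (simp add: c_def \<sigma>i)
    ultimately have "((\<lambda>t. ((\<phi> (x + t *\<^sub>R a) - \<phi> x) \<bullet> H) / t\<^sup>2)
        \<longlongrightarrow> (second_form \<phi> x (s a) \<bullet> \<sigma> H) / 2) (at 0)"
      by (rule Lim_transform_eventually)
    moreover have "((\<lambda>t. ((\<phi> (x + t *\<^sub>R a) - \<phi> x) \<bullet> H) / t\<^sup>2)
        \<longlongrightarrow> (second_form \<phi> x a \<bullet> H) / 2) (at 0)"
      by (rule second_form_along_curve[OF oU x d1 d2 line _ HD[unfolded D_def]]) simp_all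
    ultimately show ?thesis using tendsto_unique[OF trivial_limit_at] by fastforce
  qed
  have pdH: "pd k \<phi> x \<bullet> H = 0" "pd k \<phi> x \<bullet> \<sigma> H = 0" for k
    using HD[of "axis k 1"] \<sigma>H[of "axis k 1"] by (simp_all add: D_def pd_def)
  define g where "g = metric_mat \<phi> x"
  have gD: "a \<bullet> (g *v b) = D a \<bullet> D b" for a b
    unfolding g_def D_def by (rule inner_metric_mat[OF d1[OF x]])
  have Ss: "matrix s *v a = s a" for a using lins by (simp add: matrix_works linear_matrix_vector_mul_eq)
  have "transpose (matrix s) ** g ** matrix s = g"
  proof -
    have "a \<bullet> ((transpose (matrix s) ** g ** matrix s) *v b) = a \<bullet> (g *v b)" for a b
    proof -
      have "a \<bullet> ((transpose (matrix s) ** g ** matrix s) *v b) = s a \<bullet> (g *v s b)"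
        by (simp only: matrix_vector_mul_assoc[symmetric] inner_transpose_mult_vec Ss)
      then show ?thesis by (simp add: gD Ds \<sigma>i)
    qed
    then show ?thesis using vector_eq_ldot unfolding matrix_eq by blast
  qed
  moreover have "transpose g = g"
    by (simp add: g_def metric_mat_def transpose_def inner_commute vec_eq_iff)
  moreover have "g ** matrix_inv g = mat 1" using inv unfolding g_def by (rule matrix_inv_inverse)
  ultimately have "trace (matrix_inv g ** (\<chi> i j. pd j (pd i \<phi>) x \<bullet> \<sigma> H))
      = trace (matrix_inv g ** (\<chi> i j. pd j (pd i \<phi>) x \<bullet> H))"
    by (intro trace_congruence[where S = "matrix s" and g = g])
      (auto simp: Ss Qs simp flip: second_form_inner)
  \<comment> \<open>The two traces are the components of \<open>H\<close> along
    \<open>\<sigma> H\<close> and along \<open>H\<close>. As both vectors have the same length,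
    their difference has norm zero.\<close>
  then have "H \<bullet> \<sigma> H = H \<bullet> H"
    using mean_curv_inner_normal[of \<phi> x H] mean_curv_inner_normal[of \<phi> x "\<sigma> H"] pdH
    by (simp add: H_def g_def)
  then have "(\<sigma> H - H) \<bullet> (\<sigma> H - H) = 0"
    by (simp add: inner_diff_left inner_diff_right \<sigma>i inner_commute)
  then show ?thesis by (simp add: H_def)
qed

section \<open>Symmetries of the rays over the Clifford torus\<close>

text \<open>For \<open>v = 0\<close> this is the identity, since division by zero yields zero.\<close>

definition reflection :: "real^'i::finite \<Rightarrow> 'b::real_inner^'i \<Rightarrow> 'b^'i" where
  "reflection v w = (\<chi> i. w $ i - (2 * v $ i / (v \<bullet> v)) *\<^sub>R (\<Sum>j\<in>UNIV. v $ j *\<^sub>R w $ j))"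

lemma linear_reflection: "linear (reflection v)"
  by (rule linearI)
    (simp_all add: reflection_def vec_eq_iff scaleR_add_right sum.distrib scaleR_diff_right
      flip: scaleR_sum_right, simp_all add: scaleR_sum_right mult_ac)

text \<open>\<open>reflection v\<close> is the hyperplane reflection on the index coordinates
  tensored with the identity of the entry space. In the squared norm the cross term and the square
  of the correction cancel; for \<open>v = 0\<close> both coefficients are zero by division by
  zero.\<close>

lemma norm_reflection: "norm (reflection v w) = norm w"
proof -
  define k where "k = (\<Sum>j\<in>UNIV. v $ j *\<^sub>R w $ j)"
  define s where "s = v \<bullet> v"
  have "reflection v w \<bullet> reflection v w
      = (\<Sum>i\<in>UNIV. w $ i \<bullet> w $ i - (4 / s) * (v $ i * (w $ i \<bullet> k)) + (4 / s\<^sup>2) * (v $ i * v $ i) * (k \<bullet> k))"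
  proof -
    have "reflection v w = (\<chi> i. w $ i - (2 * v $ i / s) *\<^sub>R k)"
      by (simp add: reflection_def k_def s_def)
    then show ?thesis
      unfolding inner_vec_def[of "reflection v w"]
      by (intro sum.cong refl)
        (simp add: inner_diff_left inner_diff_right inner_commute power2_eq_square algebra_simps)
  qed
  also have "\<dots> = w \<bullet> w - (4 / s) * (k \<bullet> k) + (4 / s\<^sup>2) * s * (k \<bullet> k)"
  proof -
    have "(\<Sum>i\<in>UNIV. v $ i * (w $ i \<bullet> k)) = k \<bullet> k"
      by (subst (2) k_def) (simp add: inner_sum_left)
    moreover have "(\<Sum>i\<in>UNIV. v $ i * v $ i) = s" by (simp add: s_def inner_vec_def)
    ultimately show ?thesis
      by (simp only: sum.distrib sum_subtractf inner_vec_def[of w w] sum_distrib_left[symmetric]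
          sum_distrib_right[symmetric])
  qed
  also have "\<dots> = w \<bullet> w" by (cases "s = 0") (simp_all add: power2_eq_square)
  finally show ?thesis by (simp add: norm_eq_sqrt_inner)
qed

lemma reflection_self: "reflection v v = - v"
proof (cases "v = 0")
  case False
  then have "v \<bullet> v \<noteq> 0" by simp
  moreover have "(\<Sum>j\<in>UNIV. v $ j * v $ j) = v \<bullet> v" by (simp add: inner_vec_def)
  ultimately show ?thesis by (simp add: reflection_def vec_eq_iff)
qed (simp add: reflection_def vec_eq_iff)

text \<open>Equal norms give \<open>(X - Y) \<bullet> (X - Y) = 2 * ((X - Y) \<bullet> X)\<close>,
  so the reflection subtracts exactly \<open>X - Y\<close> from \<open>X\<close>. For
  \<open>X = Y\<close> it is the identity.\<close>

lemma reflection_swap: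
  fixes X Y :: "real^'n"
  assumes "norm X = norm Y"
  shows "reflection (X - Y) X = Y"
proof (cases "X = Y")
  case False
  have e: "X \<bullet> X = Y \<bullet> Y" using assms by (simp add: norm_eq)
  have s: "(\<Sum>j\<in>UNIV. (X - Y) $ j *\<^sub>R X $ j) = (X - Y) \<bullet> X" by (simp add: inner_vec_def)
  have "(X - Y) \<bullet> (X - Y) = 2 * ((X - Y) \<bullet> X)"
    by (simp add: inner_diff_left inner_diff_right e inner_commute)
  moreover have "(X - Y) \<bullet> (X - Y) \<noteq> 0" using False by simp
  ultimately show ?thesis unfolding reflection_def s vec_eq_iff by (simp add: field_simps)
qed (simp add: reflection_def vec_eq_iff)

lemma reflection_swap':
  fixes X Y :: "real^'n"
  assumes "norm X = norm Y"
  shows "reflection (X - Y) Y = X"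
proof -
  have "reflection (- v) w = reflection v w" for v w :: "real^'n"
    by (simp add: reflection_def vec_eq_iff sum_negf)
  from this[of "Y - X" Y] show ?thesis using reflection_swap[of Y X] assms by simp
qed

text \<open>The pure tensor of \<open>r\<close> with the rotated vector X + iY. Leaving
  \<open>X\<close> and \<open>Y\<close> unnormalized makes it linear in \<open>r\<close> and in the
  pair, so tangent and normal vectors have this form too.\<close>

definition ray_point :: "real^'l::finite \<Rightarrow> real \<Rightarrow> real^'n::finite \<Rightarrow> real^'n \<Rightarrow> (complex^'n)^'l" where
  "ray_point r \<alpha> X Y = (\<chi> l. \<chi> m. complex_of_real (r $ l) * cis \<alpha> * Complex (X $ m) (Y $ m))"

lemma Hset_eq_ray_points:
  "(Hset lam lam0 :: (((complex^'n::finite)^'l::finite) \<times> real) set)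
    = {(ray_point r (lam * \<Theta>) X Y, lam0 * \<Theta>) | \<Theta> r X Y. norm X = 1 \<and> norm Y = 1}"
  (is "_ = ?R")
proof (intro subset_antisym subsetI)
  fix p :: "((complex^'n)^'l) \<times> real" assume "p \<in> Hset lam lam0"
  then obtain \<Theta> r X Y where "p = ((\<chi> l. \<chi> m. complex_of_real (r l) * cis (lam * \<Theta>) * Complex (X $ m) (Y $ m)), lam0 * \<Theta>)"
    and "norm X = 1" "norm Y = 1"
    unfolding Hset_def by blast
  moreover from this have "p = (ray_point (\<chi> l. r l) (lam * \<Theta>) X Y, lam0 * \<Theta>)"
    by (simp add: ray_point_def)
  ultimately show "p \<in> ?R" by blast
next
  fix p :: "((complex^'n)^'l) \<times> real" assume "p \<in> ?R"
  then obtain \<Theta> r X Y where "p = (ray_point r (lam * \<Theta>) X Y, lam0 * \<Theta>)" "norm X = 1" "norm Y = 1"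
    by blast
  then show "p \<in> Hset lam lam0"
    unfolding Hset_def
    by (intro CollectI exI[of _ \<Theta>] exI[of _ "($) r"] exI[of _ X] exI[of _ Y]) (simp add: ray_point_def)
qed

lemma ray_point_add: "ray_point r \<alpha> (X + X') (Y + Y') = ray_point r \<alpha> X Y + ray_point r \<alpha> X' Y'"
  by (simp add: ray_point_def vec_eq_iff complex_eq_iff algebra_simps)

lemma ray_point_scaleR: "ray_point r \<alpha> (c *\<^sub>R X) (c *\<^sub>R Y) = c *\<^sub>R ray_point r \<alpha> X Y"
  by (simp add: ray_point_def vec_eq_iff complex_eq_iff algebra_simps)

lemma ray_point_scaleR_left: "ray_point (c *\<^sub>R r) \<alpha> X Y = c *\<^sub>R ray_point r \<alpha> X Y"
  by (simp add: ray_point_def vec_eq_iff complex_eq_iff algebra_simps)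

lemma ray_point_minus_left: "ray_point (- r) \<alpha> X Y = - ray_point r \<alpha> X Y"
  using ray_point_scaleR_left[of "- 1" r \<alpha> X Y] by simp

text \<open>Multiplication by the unit \<open>cis \<alpha>\<close> is an isometry, and the common
  ray factor splits off.\<close>

lemma inner_ray_point:
  "ray_point r \<alpha> X Y \<bullet> ray_point r \<alpha> X' Y' = (r \<bullet> r) * (X \<bullet> X' + Y \<bullet> Y')"
proof -
  have *: "(complex_of_real s * cis \<alpha> * Complex x y) \<bullet> (complex_of_real s * cis \<alpha> * Complex x' y')
      = (s * s) * (x * x' + y * y')" for s x y x' y'
  proof -
    have "(s * c * x - s * d * y) * (s * c * x' - s * d * y') + (s * c * y + s * d * x) * (s * c * y' + s * d * x')
        = (s * s) * (x * x' + y * y')" if "d\<^sup>2 + c\<^sup>2 = 1" for c d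
      using that by algebra
    from this[OF sin_cos_squared_add] show ?thesis by (simp add: inner_complex_def)
  qed
  have "ray_point r \<alpha> X Y \<bullet> ray_point r \<alpha> X' Y'
      = (\<Sum>l\<in>UNIV. \<Sum>m\<in>UNIV. (r $ l * r $ l) * (X $ m * X' $ m + Y $ m * Y' $ m))"
    by (simp only: inner_vec_def ray_point_def vec_lambda_beta *)
  also have "\<dots> = (r \<bullet> r) * (X \<bullet> X' + Y \<bullet> Y')"
    by (simp only: inner_vec_def inner_real_def sum.distrib[symmetric] sum_product)
  finally show ?thesis .
qed

lemma reflection_ray_point:
  "reflection v (ray_point r \<alpha> X Y) = ray_point (reflection v r) \<alpha> X Y"
proof -
  have "reflection v (ray_point r \<alpha> X Y) $ l $ m = ray_point (reflection v r) \<alpha> X Y $ l $ m" for l m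
  proof -
    have "(\<Sum>j\<in>UNIV. v $ j *\<^sub>R ray_point r \<alpha> X Y $ j) $ m
        = complex_of_real (\<Sum>j\<in>UNIV. v $ j * r $ j) * cis \<alpha> * Complex (X $ m) (Y $ m)"
      by (simp add: ray_point_def) (simp add: sum_distrib_left mult_ac scaleR_conv_of_real)
    then have "reflection v (ray_point r \<alpha> X Y) $ l $ m
        = complex_of_real (r $ l - 2 * v $ l / (v \<bullet> v) * (\<Sum>j\<in>UNIV. v $ j * r $ j)) * cis \<alpha> * Complex (X $ m) (Y $ m)"
      unfolding reflection_def vec_lambda_beta vector_minus_component vector_scaleR_component
      by (simp add: ray_point_def scaleR_conv_of_real algebra_simps)
    then show ?thesis by (simp add: ray_point_def reflection_def)
  qed
  then show ?thesis by (simp add: vec_eq_iff)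
qed

text \<open>Conjugation followed by \<open>\<i> * cis (2 * \<alpha>)\<close> reverses phases about
  \<alpha> and exchanges real and imaginary parts; \<open>v\<close> reflects the coordinates within
  each ray block.\<close>

definition conj_reflection :: "real \<Rightarrow> real^'n::finite \<Rightarrow> (complex^'n)^'l::finite \<Rightarrow> (complex^'n)^'l" where
  "conj_reflection \<alpha> v w = (\<chi> l. \<chi> m. \<i> * cis (2 * \<alpha>) * cnj (reflection v (w $ l) $ m))"

lemma linear_conj_reflection: "linear (conj_reflection \<alpha> v)"
  by (rule linearI)
    (simp_all add: conj_reflection_def vec_eq_iff linear_add[OF linear_reflection]
      linear_scale[OF linear_reflection] algebra_simps)

lemma norm_conj_reflection: "norm (conj_reflection \<alpha> v w) = norm w"
proof -
  have "norm (\<chi> m. \<i> * cis (2 * \<alpha>) * cnj (reflection v u $ m)) = norm u" for u :: "complex^'a"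
  proof -
    have "norm (\<chi> m. \<i> * cis (2 * \<alpha>) * cnj (reflection v u $ m)) = norm (reflection v u)"
      by (simp add: norm_vec_def norm_mult)
    then show ?thesis by (simp add: norm_reflection)
  qed
  then show ?thesis
    unfolding conj_reflection_def norm_vec_def[of w] by (subst norm_vec_def) simp
qed

lemma conj_reflection_ray_point:
  "conj_reflection \<alpha> v (ray_point r \<beta> X Y)
    = ray_point r (2 * \<alpha> - \<beta>) (reflection v Y) (reflection v X)"
proof -
  have 1: "reflection v (ray_point r \<beta> X Y $ l) $ m
      = complex_of_real (r $ l) * cis \<beta> * Complex (reflection v X $ m) (reflection v Y $ m)" for l m
  proof -
    have "(\<Sum>j\<in>UNIV. v $ j *\<^sub>R ray_point r \<beta> X Y $ l $ j)
        = complex_of_real (r $ l) * cis \<beta> * Complex (\<Sum>j\<in>UNIV. v $ j * X $ j) (\<Sum>j\<in>UNIV. v $ j * Y $ j)"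
      by (simp add: ray_point_def complex_eq_iff sum_distrib_left sum_subtractf sum.distrib algebra_simps)
    then show ?thesis
      by (simp add: reflection_def) (simp add: ray_point_def complex_eq_iff algebra_simps)
  qed
  have 2: "cis (2 * \<alpha> - \<beta>) = cis (2 * \<alpha>) * cnj (cis \<beta>)"
    by (simp add: cis_mult cis_cnj)
  have 3: "\<i> * cnj (Complex a b) = Complex b a" for a b by (simp add: complex_eq_iff)
  have 4: "\<i> * cis (2 * \<alpha>) * cnj (complex_of_real s * cis \<beta> * Complex a b)
      = complex_of_real s * cis (2 * \<alpha> - \<beta>) * Complex b a" for s a b
    unfolding 2 3[of a b, symmetric] by simp
  then show ?thesis unfolding conj_reflection_def 1 4 by (simp add: ray_point_def)
qed

section \<open>Invariance under the multi-screw motion\<close>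

lemma multi_screw_ray_point:
  "multi_screw lam0 (\<lambda>_. lam) \<theta> (ray_point r (lam * \<Theta>) X Y, lam0 * \<Theta>)
    = (ray_point r (lam * (\<Theta> + \<theta>)) X Y, lam0 * (\<Theta> + \<theta>))"
proof -
  have "cis (lam * (\<Theta> + \<theta>)) = cis (lam * \<theta>) * cis (lam * \<Theta>)"
    by (simp add: cis_mult algebra_simps)
  then show ?thesis by (simp add: multi_screw_def ray_point_def vec_eq_iff algebra_simps)
qed

lemma multi_screw_image_Hset:
  "multi_screw lam0 (\<lambda>_. lam) \<theta> ` (Hset lam lam0 :: (((complex^'n::finite)^'l::finite) \<times> real) set)
    = Hset lam lam0"
  (is "_ ` ?M = _")
proof
  show "multi_screw lam0 (\<lambda>_. lam) \<theta> ` ?M \<subseteq> Hset lam lam0"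
  proof (rule image_subsetI)
    fix p :: "((complex^'n)^'l) \<times> real" assume "p \<in> ?M"
    then obtain \<Theta> r X Y where "p = (ray_point r (lam * \<Theta>) X Y, lam0 * \<Theta>)" "norm X = 1" "norm Y = 1"
      unfolding Hset_eq_ray_points by blast
    then show "multi_screw lam0 (\<lambda>_. lam) \<theta> p \<in> Hset lam lam0"
      unfolding Hset_eq_ray_points using multi_screw_ray_point by blast
  qed
  show "?M \<subseteq> multi_screw lam0 (\<lambda>_. lam) \<theta> ` ?M"
  proof
    fix p :: "((complex^'n)^'l) \<times> real" assume "p \<in> ?M"
    then obtain \<Theta> r X Y where p: "p = (ray_point r (lam * \<Theta>) X Y, lam0 * \<Theta>)" "norm X = 1" "norm Y = 1"
      unfolding Hset_eq_ray_points by blast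
    then have "p = multi_screw lam0 (\<lambda>_. lam) \<theta> (ray_point r (lam * (\<Theta> - \<theta>)) X Y, lam0 * (\<Theta> - \<theta>))"
      by (simp add: multi_screw_ray_point)
    then show "p \<in> multi_screw lam0 (\<lambda>_. lam) \<theta> ` ?M"
      using p unfolding Hset_eq_ray_points by blast
  qed
qed

section \<open>Minimality\<close>

lemma orthogonal_transformation_Pair_scale:
  fixes f :: "'a::euclidean_space \<Rightarrow> 'a"
  assumes "linear f" "\<And>w. norm (f w) = norm w" "\<bar>s\<bar> = 1"
  shows "orthogonal_transformation (\<lambda>p :: 'a \<times> real. (f (fst p), s * snd p))"
  unfolding orthogonal_transformation
proof (intro conjI allI)
  show "linear (\<lambda>p :: 'a \<times> real. (f (fst p), s * snd p))"
    by (rule linearI) (simp_all add: linear_add[OF assms(1)] linear_scale[OF assms(1)] algebra_simps)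
  fix p :: "'a \<times> real"
  show "norm (f (fst p), s * snd p) = norm p"
    using assms(2,3) by (simp add: norm_prod_def abs_mult power_mult_distrib)
qed

text \<open>If the part of \<open>a\<close> orthogonal to \<open>X\<close> were nonzero, its
  normalization would be an admissible \<open>X'\<close> with nonzero product with \<open>a\<close>.
  In dimension one there is no such \<open>X'\<close>, and the argument still applies.\<close>

lemma orthogonal_to_unit_complement:
  fixes a X :: "'a::real_inner"
  assumes "norm X = 1" and perp: "\<And>X'. norm X' = 1 \<Longrightarrow> X \<bullet> X' = 0 \<Longrightarrow> X' \<bullet> a = 0"
  shows "a = (X \<bullet> a) *\<^sub>R X"
proof (rule ccontr)
  define d where "d = a - (X \<bullet> a) *\<^sub>R X"
  assume "a \<noteq> (X \<bullet> a) *\<^sub>R X"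
  then have "d \<noteq> 0" by (simp add: d_def)
  have Xd: "X \<bullet> d = 0" using assms(1) by (simp add: d_def inner_diff_right norm_eq_1)
  have "(d /\<^sub>R norm d) \<bullet> a = 0" using \<open>d \<noteq> 0\<close> Xd by (intro perp) simp_all
  then have "d \<bullet> a = 0" using \<open>d \<noteq> 0\<close> by simp
  moreover have "d \<bullet> d = d \<bullet> a - (X \<bullet> a) * (X \<bullet> d)"
    by (subst (2) d_def) (simp add: inner_diff_right inner_commute)
  ultimately have "d \<bullet> d = 0" using Xd by simp
  with \<open>d \<noteq> 0\<close> show False by simp
qed

lemma minimal_Hset:
  "minimal_set TYPE('k::finite) (Hset lam lam0 :: (((complex^'n::finite)^'l::finite) \<times> real) set)"
  (is "minimal_set _ ?M")
  unfolding minimal_set_def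
proof (intro allI impI ballI)
  fix U and \<phi> :: "real^'k \<Rightarrow> ((complex^'n)^'l) \<times> real" and x
  assume reg: "regular_param ?M U \<phi>" and x: "x \<in> U"
  have M: "?M = {(ray_point r (lam * \<Theta>) X Y, lam0 * \<Theta>) | \<Theta> r X Y. norm X = 1 \<and> norm Y = 1}"
    by (rule Hset_eq_ray_points)
  have MI: "(ray_point r (lam * \<Theta>) X Y, lam0 * \<Theta>) \<in> ?M" if "norm X = 1" "norm Y = 1" for r X Y \<Theta>
    unfolding M using that by blast
  have "\<phi> x \<in> ?M" using reg x by (auto simp: regular_param_def openin_open)
  then obtain \<Theta> r X Y where p: "\<phi> x = (ray_point r (lam * \<Theta>) X Y, lam0 * \<Theta>)"
    and X: "norm X = 1" and Y: "norm Y = 1"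
    unfolding M by blast
  define \<alpha> where "\<alpha> = lam * \<Theta>"
  obtain h \<eta> where H: "mean_curv \<phi> x = (h, \<eta>)" by fastforce

  define A :: "real^'n \<Rightarrow> real^'n" where "A = reflection (X - Y)"
  have AX: "A X = Y" and AY: "A Y = X"
    using X Y by (simp_all add: A_def reflection_swap reflection_swap')
  have normA: "norm (A w) = norm w" for w unfolding A_def by (rule norm_reflection)
  \<comment> \<open>With the vertical coordinate reversed this is the linear part of the half-turn:
    the parameter \<Theta>' goes to 2 \<Theta> - \<Theta>', and the base point is fixed because
    \<open>A\<close> undoes the exchange of \<open>X\<close> and \<open>Y\<close>.\<close>
  define C :: "(complex^'n)^'l \<Rightarrow> (complex^'n)^'l" where "C = conj_reflection \<alpha> (X - Y)"
  have C: "C (ray_point s \<beta> V W) = ray_point s (2 * \<alpha> - \<beta>) (A W) (A V)" for s \<beta> V W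
    unfolding C_def A_def by (rule conj_reflection_ray_point)
  have linC: "linear C" unfolding C_def by (rule linear_conj_reflection)
  have "(\<lambda>p. (C (fst p), - 1 * snd p)) (mean_curv \<phi> x) = mean_curv \<phi> x"
  proof (rule mean_curv_fixed_by_isometry[OF reg x])
    show "orthogonal_transformation (\<lambda>p :: ((complex^'n)^'l) \<times> real. (C (fst p), - 1 * snd p))"
      by (rule orthogonal_transformation_Pair_scale) (simp_all add: linC, simp add: C_def norm_conj_reflection)
    fix q assume "q \<in> ?M"
    then obtain \<Theta>' r' X' Y' where q: "q = (ray_point r' (lam * \<Theta>') X' Y', lam0 * \<Theta>')"
      and "norm X' = 1" "norm Y' = 1"
      unfolding M by blast
    then have "(ray_point r' (lam * (2 * \<Theta> - \<Theta>')) (A Y') (A X'), lam0 * (2 * \<Theta> - \<Theta>')) \<in> ?M"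
      by (intro MI) (simp_all add: normA)
    also have "(ray_point r' (lam * (2 * \<Theta> - \<Theta>')) (A Y') (A X'), lam0 * (2 * \<Theta> - \<Theta>'))
        = \<phi> x + (C (fst (q - \<phi> x)), - 1 * snd (q - \<phi> x))"
      unfolding p q by (simp add: linear_diff[OF linC] C AX AY \<alpha>_def algebra_simps)
    finally show "\<phi> x + (C (fst (q - \<phi> x)), - 1 * snd (q - \<phi> x)) \<in> ?M" .
  qed
  then have Ch: "C h = h" and "\<eta> = 0" by (simp_all add: H)

  \<comment> \<open>The reflection sends \<open>r\<close> to \<open>- r\<close>, so its negative
    fixes the base point; it changes only ray coefficients, which are arbitrary in the set.\<close>
  define R :: "(complex^'n)^'l \<Rightarrow> (complex^'n)^'l" where "R = reflection r"
  have linR: "linear R" unfolding R_def by (rule linear_reflection)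
  have "(\<lambda>p. (- R (fst p), 1 * snd p)) (mean_curv \<phi> x) = mean_curv \<phi> x"
  proof (rule mean_curv_fixed_by_isometry[OF reg x])
    show "orthogonal_transformation (\<lambda>p :: ((complex^'n)^'l) \<times> real. (- R (fst p), 1 * snd p))"
      by (rule orthogonal_transformation_Pair_scale)
        (simp_all add: linear_compose_neg[OF linR], simp add: R_def norm_reflection)
    fix q assume "q \<in> ?M"
    then obtain \<Theta>' r' X' Y' where q: "q = (ray_point r' (lam * \<Theta>') X' Y', lam0 * \<Theta>')"
      and "norm X' = 1" "norm Y' = 1"
      unfolding M by blast
    then have "(ray_point (- reflection r r') (lam * \<Theta>') X' Y', lam0 * \<Theta>') \<in> ?M"
      by (intro MI)
    also have "(ray_point (- reflection r r') (lam * \<Theta>') X' Y', lam0 * \<Theta>')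
        = \<phi> x + (- R (fst (q - \<phi> x)), 1 * snd (q - \<phi> x))"
      unfolding p q by (simp add: R_def linear_diff[OF linear_reflection] reflection_ray_point reflection_self ray_point_minus_left)
    finally show "\<phi> x + (- R (fst (q - \<phi> x)), 1 * snd (q - \<phi> x)) \<in> ?M" .
  qed
  then have "- R h = h" by (simp add: H)
  then have Rh: "R h = - h" by (metis minus_minus)
  define S where "S = (\<Sum>j\<in>UNIV. r $ j *\<^sub>R h $ j)"
  define k where "k = (1 / (r \<bullet> r)) *\<^sub>R S"
  \<comment> \<open>The eigenspace of \<open>R\<close> for -1 consists of the multiples of
    \<open>r\<close> in the ray coordinates. If \<open>r = 0\<close>, then \<open>k = 0\<close> by
    division by zero, and \<open>R h = - h\<close> with \<open>R\<close> the identity still gives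
    \<open>h = 0\<close>.\<close>
  have hk: "h $ l = r $ l *\<^sub>R k" for l
  proof -
    define T where "T = (2 * r $ l / (r \<bullet> r)) *\<^sub>R S"
    have "h $ l - T = - (h $ l)"
      using arg_cong[OF Rh, of "\<lambda>w. w $ l"] by (simp add: R_def reflection_def T_def S_def)
    then have "h $ l - T + (T + h $ l) = T" by simp
    then have "2 *\<^sub>R h $ l = T" by (simp add: scaleR_2)
    also have "T = 2 *\<^sub>R (r $ l *\<^sub>R k)" by (simp add: T_def k_def)
    finally show ?thesis by (rule scaleR_left_imp_eq[rotated]) simp
  qed
  \<comment> \<open>Removing the phase from \<open>k\<close> brings \<open>h\<close> into the form
    of a \<open>ray_point\<close> with the same \<open>r\<close> and \<open>\<alpha>\<close> as the
    base point, so \<open>inner_ray_point\<close> applies.\<close>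
  define a b where "a = (\<chi> m. Re (cnj (cis \<alpha>) * k $ m))" and "b = (\<chi> m. Im (cnj (cis \<alpha>) * k $ m))"
  have h: "h = ray_point r \<alpha> a b"
  proof -
    have "k $ m = cis \<alpha> * Complex (a $ m) (b $ m)" for m
    proof -
      have "Complex (a $ m) (b $ m) = cnj (cis \<alpha>) * k $ m" by (simp add: a_def b_def complex_eq_iff)
      moreover have "cis \<alpha> * cnj (cis \<alpha>) = 1" by (simp add: cis_cnj cis_mult)
      ultimately show ?thesis by (simp flip: mult.assoc)
    qed
    then show ?thesis by (simp add: vec_eq_iff hk ray_point_def) (simp add: scaleR_conv_of_real mult.assoc)
  qed

  show "mean_curv \<phi> x = 0"
  proof (cases "r = 0")
    case True
    then have "h = 0" by (simp add: vec_eq_iff hk)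
    with \<open>\<eta> = 0\<close> show ?thesis by (simp add: H zero_prod_def)
  next
    case False
    have tangent: "X' \<bullet> a + Y' \<bullet> b = 0"
      if "((\<lambda>t. (c t, lam0 * \<Theta>)) has_vector_derivative (ray_point r \<alpha> X' Y', 0)) (at 0)"
        "c 0 = ray_point r \<alpha> X Y" "\<And>t. (c t, lam0 * \<Theta>) \<in> ?M" for c X' Y'
    proof -
      have "(ray_point r \<alpha> X' Y', 0) \<bullet> mean_curv \<phi> x = 0"
        using that by (intro curve_velocity_orthogonal_mean_curv[OF reg x that(1)]) (simp_all add: p \<alpha>_def)
      then show ?thesis using False by (simp add: H h inner_ray_point)
    qed
    \<comment> \<open>The ray through the base point lies in the set; its velocity is the position
      vector itself.\<close>
    have 0: "X \<bullet> a + Y \<bullet> b = 0"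
    proof (rule tangent[of "\<lambda>t. (1 + t) *\<^sub>R ray_point r \<alpha> X Y"])
      show "((\<lambda>t. ((1 + t) *\<^sub>R ray_point r \<alpha> X Y, lam0 * \<Theta>)) has_vector_derivative (ray_point r \<alpha> X Y, 0)) (at 0)"
        by (auto intro!: derivative_eq_intros has_vector_derivative_Pair)
      show "((1 + t) *\<^sub>R ray_point r \<alpha> X Y, lam0 * \<Theta>) \<in> ?M" for t
        unfolding ray_point_scaleR_left[symmetric] \<alpha>_def by (rule MI[OF X Y])
    qed simp
    have unit: "norm (cos t *\<^sub>R V + sin t *\<^sub>R V') = 1"
      if "norm V = 1" "norm V' = 1" "V \<bullet> V' = 0" for V V' :: "real^'n" and t
      using that by (simp add: norm_eq_1 inner_add_left inner_add_right inner_commute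
          flip: power2_eq_square)
    have rot: "((\<lambda>t. cos t *\<^sub>R v + sin t *\<^sub>R w + u) has_vector_derivative w) (at 0)" 
      for u v w :: "(complex^'n)^'l"
      by (auto intro!: derivative_eq_intros)
    have a: "a = (X \<bullet> a) *\<^sub>R X"
    proof (rule orthogonal_to_unit_complement[OF X])
      fix X' assume X': "norm X' = 1" "X \<bullet> X' = 0"
      \<comment> \<open>A great circle in the first sphere with \<open>Y\<close> held fixed, split
        by linearity so that its derivative at 0 can be read off from \<open>rot\<close>.\<close>
      let ?c = "\<lambda>t. cos t *\<^sub>R ray_point r \<alpha> X 0 + sin t *\<^sub>R ray_point r \<alpha> X' 0 + ray_point r \<alpha> 0 Y"
      have c: "?c t = ray_point r \<alpha> (cos t *\<^sub>R X + sin t *\<^sub>R X') Y" for t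
        by (simp flip: ray_point_scaleR ray_point_add)
      have "X' \<bullet> a + 0 \<bullet> b = 0"
      proof (rule tangent[of ?c])
        show "((\<lambda>t. (?c t, lam0 * \<Theta>)) has_vector_derivative (ray_point r \<alpha> X' 0, 0)) (at 0)"
          by (intro has_vector_derivative_Pair rot has_vector_derivative_const)
        show "(?c t, lam0 * \<Theta>) \<in> ?M" for t
          unfolding c unfolding \<alpha>_def by (intro MI unit X Y X')
      qed (simp flip: ray_point_add)
      then show "X' \<bullet> a = 0" by simp
    qed
    have b: "b = (Y \<bullet> b) *\<^sub>R Y"
    proof (rule orthogonal_to_unit_complement[OF Y])
      fix Y' assume Y': "norm Y' = 1" "Y \<bullet> Y' = 0"
      let ?c = "\<lambda>t. cos t *\<^sub>R ray_point r \<alpha> 0 Y + sin t *\<^sub>R ray_point r \<alpha> 0 Y' + ray_point r \<alpha> X 0"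
      have c: "?c t = ray_point r \<alpha> X (cos t *\<^sub>R Y + sin t *\<^sub>R Y')" for t
        by (simp flip: ray_point_scaleR ray_point_add)
      have "0 \<bullet> a + Y' \<bullet> b = 0"
      proof (rule tangent[of ?c])
        show "((\<lambda>t. (?c t, lam0 * \<Theta>)) has_vector_derivative (ray_point r \<alpha> 0 Y', 0)) (at 0)"
          by (intro has_vector_derivative_Pair rot has_vector_derivative_const)
        show "(?c t, lam0 * \<Theta>) \<in> ?M" for t
          unfolding c unfolding \<alpha>_def by (intro MI unit X Y Y')
      qed (simp flip: ray_point_add)
      then show "Y' \<bullet> b = 0" by simp
    qed
    \<comment> \<open>With \<open>a\<close> and \<open>b\<close> multiples of \<open>X\<close> and
      \<open>Y\<close>, the relation \<open>0\<close> makes the coefficients opposite; one scalar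
      remains, along the direction X - iY.\<close>
    define s where "s = X \<bullet> a"
    have "Y \<bullet> b = - s" using 0 by (simp add: s_def)
    then have "b = s *\<^sub>R (- Y)" using b by simp
    moreover have "a = s *\<^sub>R X" using a by (simp add: s_def)
    ultimately have h': "h = s *\<^sub>R ray_point r \<alpha> X (- Y)" unfolding h by (simp only: ray_point_scaleR)
    \<comment> \<open>\<open>C\<close> keeps the phase \<alpha> and sends the pair (X, -Y) to (-X,
      Y), so \<open>h\<close> is reversed although \<open>C\<close> fixes it.\<close>
    have "A (- Y) = - X" using linear_neg[OF linear_reflection] AY unfolding A_def by metis
    then have "C h = s *\<^sub>R ray_point r \<alpha> (- X) Y" unfolding h' by (simp add: linear_scale[OF linC] C AX)
    also have "\<dots> = - h" using ray_point_scaleR[of r \<alpha> "- 1" X "- Y"] by (simp add: h')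
    finally have "h = - h" using Ch by simp
    then have "2 *\<^sub>R h = 0" unfolding scaleR_2 by (metis add.right_inverse)
    then have "h = 0" by simp
    with \<open>\<eta> = 0\<close> show ?thesis by (simp add: H zero_prod_def)
  qed
qed

theorem theorem3p3:
  fixes lam lam0 :: real
  shows "minimal_set TYPE('k::finite) (Hset lam lam0 :: (((complex^'n::finite)^'l::finite) \<times> real) set)
       \<and> (\<forall>\<theta>. multi_screw lam0 (\<lambda>_. lam) \<theta> ` (Hset lam lam0 :: (((complex^'n)^'l) \<times> real) set)
              = Hset lam lam0)"
  using minimal_Hset multi_screw_image_Hset by blast

end
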